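(* The function $f:[0,1]\to[\frac12,1]$ defined by $$f\left(\Delta^2_{\alpha_1\alpha_2\ldots\alpha_{2n-1}\alpha_{2n}\ldots}\right)=\Delta^{A_2}_{\left(\frac12\right)^{1-\alpha_1}\left(\frac12\right)^{\alpha_2}\ldots\left(\frac12\right)^{1-\alpha_{2n-1}}\left(\frac12\right)^{\alpha_{2n}}\ldots},\qquad \alpha_n\in\{0,1\},$$ is continuous and strictly decreasing on $[0,1]$. Moreover, $f(0)=1$ and $f(1)=\frac12$.
   Context: For a sequence $(\alpha_n)_{n\ge1}$ with $\alpha_n\in\{0,1\}$, $\Delta^2_{\alpha_1\alpha_2\ldots\alpha_n\ldots}=\sum_{n=1}^\infty \frac{\alpha_n}{2^n}\in[0,1]$ denotes the classical binary representation. Let $A_2=\{\frac12,1\}$. For a sequence $(a_n)_{n\ge1}$ with $a_n\in A_2$, $\Delta^{A_2}_{a_1a_2\ldots a_n\ldots}$ denotes the value of the infinite continued fraction $$[0;a_1,a_2,a_3,\ldots]=\cfrac{1}{a_1+\cfrac{1}{a_2+\cfrac{1}{a_3+\cdots}}},$$ i.e. the limit of its convergents $p_n/q_n$, where $p_n=a_np_{n-1}+p_{n-2}$, $q_n=a_nq_{n-1}+q_{n-2}$ for $n\ge1$, with $p_0=0$, $q_0=1$, $p_{-1}=1$, $q_{-1}=0$. These limits exist and lie in $[\frac12,1]$. In the definition of $f$, the $n$-th digit of the continued fraction is $(\frac12)^{1-\alpha_n}$ for odd $n$ and $(\frac12)^{\alpha_n}$ for even $n$. The function $f$ is well-defined: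 the two binary representations of a binary-rational number yield the same value. *)

theory Defs
  imports Complex_Main
begin

text \<open>Sequences are indexed from 1, as in the usual notation for digits; the entry at index 0
  is never used.\<close>

definition binary_seq :: "(nat \<Rightarrow> nat) \<Rightarrow> bool" where
  "binary_seq \<alpha> \<longleftrightarrow> (\<forall>n\<ge>1. \<alpha> n \<in> {0, 1})"

definition binary_value :: "(nat \<Rightarrow> nat) \<Rightarrow> real" where
  "binary_value \<alpha> = (\<Sum>n. real (\<alpha> (Suc n)) / 2 ^ Suc n)"

text \<open>Numerators and denominators of the convergents of \<open>[0; a 1, a 2, \<dots>]\<close>. The second equations
  are the general recurrences at index 1, evaluated with the values \<open>1\<close> (numerator) and \<open>0\<close>
  (denominator) at index \<open>-1\<close>.\<close>

fun cf_num :: "(nat \<Rightarrow> real) \<Rightarrow> nat \<Rightarrow> real" where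
  "cf_num a 0 = 0"
| "cf_num a (Suc 0) = a 1 * cf_num a 0 + 1"
| "cf_num a (Suc (Suc n)) = a (Suc (Suc n)) * cf_num a (Suc n) + cf_num a n"

fun cf_den :: "(nat \<Rightarrow> real) \<Rightarrow> nat \<Rightarrow> real" where
  "cf_den a 0 = 1"
| "cf_den a (Suc 0) = a 1 * cf_den a 0 + 0"
| "cf_den a (Suc (Suc n)) = a (Suc (Suc n)) * cf_den a (Suc n) + cf_den a n"

definition cf_value :: "(nat \<Rightarrow> real) \<Rightarrow> real" where
  "cf_value a = lim (\<lambda>n. cf_num a n / cf_den a n)"

definition A2_digits :: "(nat \<Rightarrow> nat) \<Rightarrow> nat \<Rightarrow> real" where
  "A2_digits \<alpha> n = (if odd n then (1/2) ^ (1 - \<alpha> n) else (1/2) ^ \<alpha> n)"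

text \<open>The description picks the common value over all binary representations of \<open>x\<close>; it is
  meaningful only for \<open>x\<close> in the unit interval.\<close>

definition binary_to_A2 :: "real \<Rightarrow> real" where
  "binary_to_A2 x = (THE y. \<exists>\<alpha>. binary_seq \<alpha> \<and> x = binary_value \<alpha> \<and> y = cf_value (A2_digits \<alpha>))"

end

theory Submission
  imports Defs "HOL-Analysis.Uniform_Limit"
begin

text \<open>
  Complementing the digits after the first one absorbs the parity in the definition of the
  \<open>A\<^sub>2\<close>-digits, so the function \<open>f\<close> has to satisfy
  \<open>f x = 1 / (1/2 + f (1 - 2 * x))\<close> on the left half of the unit interval and
  \<open>f x = 1 / (1 + f (2 - 2 * x))\<close> on the right half. Iterating this equation from the affine
  function with the right end values gives continuous decreasing functions. They converge
  uniformly, because unfolding \<open>n\<close> steps produces a continued fraction whose distance from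
  its \<open>n\<close>-th convergent is at most \<open>8 / n\<close>. The same estimate, applied to the limit along a
  binary expansion, identifies the limit with the continued fraction. The functional equation
  makes the limit strictly decreasing on the dyadic grids, hence everywhere.
\<close>

section \<open>Convergents\<close>

lemma cf_den_ge_half:
  assumes "\<And>k. k \<ge> 1 \<Longrightarrow> a k \<ge> 1/2"
  shows "cf_den a n \<ge> 1/2"
proof (induction n rule: less_induct)
  case (less n)
  show ?case
  proof (cases "n < 2")
    case True
    then consider "n = 0" | "n = Suc 0" by linarith
    then show ?thesis using assms[of 1] by cases auto
  next
    case False
    then obtain m where n: "n = Suc (Suc m)" by (metis add_2_eq_Suc le_add_diff_inverse not_less)
    have "cf_den a m \<ge> 1/2" "cf_den a (Suc m) \<ge> 1/2" using less n by auto
    moreover have "a n * cf_den a (Suc m) \<ge> 0"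
      using calculation assms[of n] n by (intro mult_nonneg_nonneg) auto
    ultimately show ?thesis using n by simp
  qed
qed

text \<open>The recurrence adds \<open>a (n + 2) * q^2\<close> with
  \<open>q = cf_den a (n + 1)\<close> at each step, which is at least 1/8. This crude linear growth
  is enough for convergence.\<close>

lemma cf_den_mult_ge:
  assumes "\<And>k. k \<ge> 1 \<Longrightarrow> a k \<ge> 1/2"
  shows "cf_den a n * cf_den a (Suc n) \<ge> real (Suc n) / 8"
proof (induction n)
  case 0
  then show ?case using assms[of 1] by simp
next
  case (Suc n)
  let ?q = "cf_den a (Suc n)"
  have q: "?q \<ge> 1/2" using cf_den_ge_half[OF assms] .
  have "1/2 * (1/2 * (1/2)) \<le> a (Suc (Suc n)) * (?q * ?q)"
    using q assms[of "Suc (Suc n)"] by (intro mult_mono) auto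
  then show ?case using Suc by (simp add: algebra_simps)
qed

lemma cf_determinant:
  "cf_num a (Suc n) * cf_den a n - cf_num a n * cf_den a (Suc n) = (-1) ^ n"
  by (induction n) (auto simp: algebra_simps)

text \<open>Here \<open>t k\<close> is the tail of the fraction after \<open>k\<close> digits, and
  \<open>t 0\<close> is a Moebius image of a later tail, in multiplied-out form. Writing the tail as
  \<open>1 / s\<close> and clearing \<open>s\<close> reproduces the recurrence of the
  convergents.\<close>

lemma cf_complete_quotient:
  assumes "\<And>k. k \<le> n \<Longrightarrow> t k = 1 / (a (Suc k) + t (Suc k))"
    and "\<And>k. k \<le> n \<Longrightarrow> a (Suc k) + t (Suc k) \<noteq> 0"
  shows "t 0 * (cf_den a (Suc n) + t (Suc n) * cf_den a n) = cf_num a (Suc n) + t (Suc n) * cf_num a n"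
  using assms
proof (induction n)
  case 0
  then show ?case using "0.prems"(1)[of 0] "0.prems"(2)[of 0] by simp
next
  case (Suc n)
  define s where "s = a (Suc (Suc n)) + t (Suc (Suc n))"
  have s: "s \<noteq> 0" "t (Suc n) = 1 / s"
    using Suc.prems(1,2)[of "Suc n"] by (auto simp: s_def)
  have "t 0 * (cf_den a (Suc n) + t (Suc n) * cf_den a n)
      = cf_num a (Suc n) + t (Suc n) * cf_num a n"
    by (rule Suc.IH; rule Suc.prems; simp)
  then have "t 0 * (s * cf_den a (Suc n) + cf_den a n) = s * cf_num a (Suc n) + cf_num a n"
    unfolding s(2) using s(1) by (simp add: field_simps)
  then show ?case by (simp add: s_def algebra_simps)
qed

text \<open>Only the first \<open>n\<close> tail equations are assumed, so that the bound serves
  finite iterates as well as their limit. The determinant identity reduces the error to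
  \<open>s / (q' * (q' + s * q))\<close>.\<close>

lemma cf_convergent_error:
  assumes t: "\<And>k. k < n \<Longrightarrow> t k = 1 / (a (Suc k) + t (Suc k))"
    and pos: "\<And>k. k \<le> n \<Longrightarrow> t k > 0"
    and a: "\<And>k. k \<ge> 1 \<Longrightarrow> a k \<ge> 1/2"
    and n: "n > 0"
  shows "\<bar>t 0 - cf_num a n / cf_den a n\<bar> \<le> 8 / real n"
proof -
  obtain m where m: "n = Suc m" using n gr0_conv_Suc by blast
  define p q p' q' s where
    defs: "p = cf_num a m" "q = cf_den a m" "p' = cf_num a n" "q' = cf_den a n" "s = t n"
  have ne: "a (Suc k) + t (Suc k) \<noteq> 0" if "k \<le> m" for k
    using pos[of "Suc k"] a[of "Suc k"] that m by auto
  have eq: "t 0 * (q' + s * q) = p' + s * p"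
    using cf_complete_quotient[of m t a] t ne m by (auto simp: defs)
  have q: "q > 0" "q' > 0"
    using cf_den_ge_half[of a m, OF a] cf_den_ge_half[of a n, OF a] by (auto simp: defs)
  have s: "s > 0" using pos by (simp add: defs)
  have det: "\<bar>p * q' - p' * q\<bar> = 1"
  proof -
    have "p' * q - p * q' = (-1) ^ m" using cf_determinant[of a m] m by (simp add: defs)
    then have "\<bar>p' * q - p * q'\<bar> = 1" by (simp add: power_abs)
    then show ?thesis by (simp add: abs_minus_commute)
  qed
  have den: "q' + s * q > 0" using q s by (simp add: add_pos_pos)
  have "(t 0 - p' / q') * (q' * (q' + s * q)) = t 0 * (q' + s * q) * q' - p' * (q' + s * q)"
    using q by (simp add: field_simps)
  also have "\<dots> = s * (p * q' - p' * q)" unfolding eq by (simp add: algebra_simps)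
  finally have "t 0 - p' / q' = s * (p * q' - p' * q) / (q' * (q' + s * q))"
    using q den by (simp add: eq_divide_eq)
  then have "\<bar>t 0 - p' / q'\<bar> = s / (q' * (q' + s * q))"
    using q den s det by (simp add: abs_mult)
  \<comment> \<open>Dropping \<open>q'\<close> from the sum lets \<open>s\<close> cancel, which
    makes the bound independent of the tail.\<close>
  also have "\<dots> \<le> s / (q' * (s * q))"
    using q s by (intro divide_left_mono mult_left_mono mult_pos_pos) (auto simp: add_pos_pos)
  also have "\<dots> = 1 / (q * q')" using q s by (simp add: field_simps)
  also have "\<dots> \<le> 1 / (real n / 8)"
    using cf_den_mult_ge[of a m, OF a] m q by (intro divide_left_mono) (auto simp: defs)
  finally show ?thesis by (simp add: defs)
qed

text \<open>Any positive solution of the tail equations attracts the convergents with error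
  \<open>8 / n\<close>, so their limit exists and equals \<open>t 0\<close>.\<close>

lemma cf_value_eqI:
  assumes "\<And>k. t k = 1 / (a (Suc k) + t (Suc k))"
    and "\<And>k. t k > 0"
    and "\<And>k. k \<ge> 1 \<Longrightarrow> a k \<ge> 1/2"
  shows "cf_value a = t 0"
proof -
  have error: "\<bar>t 0 - cf_num a n / cf_den a n\<bar> \<le> 8 / real n" if "n > 0" for n
    by (rule cf_convergent_error) (rule assms that | assumption)+
  have "(\<lambda>n. t 0 - cf_num a n / cf_den a n) \<longlonglongrightarrow> 0"
  proof (rule Lim_null_comparison)
    show "\<forall>\<^sub>F n in sequentially. norm (t 0 - cf_num a n / cf_den a n) \<le> 8 / real n"
      using eventually_gt_at_top[of 0]
      by eventually_elim (simp add: error)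
    show "(\<lambda>n. 8 / real n) \<longlonglongrightarrow> 0" by (rule lim_const_over_n)
  qed
  from tendsto_diff[OF tendsto_const[of "t 0"] this]
  have "(\<lambda>n. cf_num a n / cf_den a n) \<longlonglongrightarrow> t 0" by simp
  then show ?thesis unfolding cf_value_def by (rule limI)
qed

section \<open>Binary expansions\<close>

lemma binary_seq_shift: "binary_seq \<alpha> \<Longrightarrow> binary_seq (\<lambda>n. \<alpha> (n + k))"
  by (auto simp: binary_seq_def)

lemma binary_seq_le:
  assumes "binary_seq \<alpha>"
  shows "real (\<alpha> (Suc n)) \<le> 1"
  using assms[unfolded binary_seq_def, rule_format, of "Suc n"] by auto

lemma power_half_sums_1: "(\<lambda>n. 1 / 2 ^ Suc n) sums (1::real)"
  using power_half_series by (simp add: power_divide)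

lemma summable_binary:
  assumes "binary_seq \<alpha>"
  shows "summable (\<lambda>n. real (\<alpha> (Suc n)) / 2 ^ Suc n)"
proof (rule summable_comparison_test')
  show "summable (\<lambda>n. 1 / 2 ^ Suc n :: real)" using power_half_sums_1 sums_summable by blast
  show "norm (real (\<alpha> (Suc n)) / 2 ^ Suc n) \<le> 1 / 2 ^ Suc n" for n
    using binary_seq_le[OF assms, of n] by (simp add: divide_right_mono)
qed

lemma binary_value_bounds:
  assumes "binary_seq \<alpha>"
  shows "binary_value \<alpha> \<in> {0..1}"
proof -
  have "binary_value \<alpha> \<le> (\<Sum>n. 1 / 2 ^ Suc n)"
    unfolding binary_value_def
    using summable_binary[OF assms] power_half_sums_1 binary_seq_le[OF assms]
    by (intro suminf_le) (auto simp: divide_right_mono sums_iff)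
  moreover have "binary_value \<alpha> \<ge> 0"
    unfolding binary_value_def using summable_binary[OF assms] by (intro suminf_nonneg) auto
  ultimately show ?thesis using power_half_sums_1 by (auto simp: sums_iff)
qed

lemma binary_value_unfold:
  assumes "binary_seq \<alpha>"
  shows "binary_value \<alpha> = (real (\<alpha> 1) + binary_value (\<lambda>n. \<alpha> (n + 1))) / 2"
proof -
  let ?c = "\<lambda>n. real (\<alpha> (Suc n)) / 2 ^ Suc n"
  have "binary_value \<alpha> = ?c 0 + (\<Sum>n. ?c (Suc n))"
    unfolding binary_value_def using suminf_split_head[OF summable_binary[OF assms]] by simp
  also have "(\<Sum>n. ?c (Suc n)) = (\<Sum>n. real (\<alpha> (Suc n + 1)) / 2 ^ Suc n / 2)" by simp
  also have "\<dots> = binary_value (\<lambda>n. \<alpha> (n + 1)) / 2"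
    unfolding binary_value_def
    using summable_binary[OF binary_seq_shift[OF assms, of 1]] by (intro suminf_divide) simp
  finally show ?thesis by (simp add: add_divide_distrib)
qed

text \<open>Greedy expansion: \<open>s n\<close> is the remainder after \<open>n\<close> digits,
  rescaled by \<open>2 ^ n\<close>. The point 1 is fixed by the doubling step and receives only
  digits 1.\<close>

lemma binary_expansion_exists:
  fixes x :: real
  assumes "x \<in> {0..1}"
  obtains \<alpha> where "binary_seq \<alpha>" "binary_value \<alpha> = x"
proof -
  define s where "s = rec_nat x (\<lambda>_ y. if y \<ge> 1/2 then 2 * y - 1 else 2 * y)"
  have s_rec: "s 0 = x" "s (Suc n) = (if s n \<ge> 1/2 then 2 * s n - 1 else 2 * s n)" for n
    by (auto simp: s_def)
  define \<alpha> where "\<alpha> n = (if s (n - 1) \<ge> 1/2 then 1 else 0 :: nat)" for n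
  have s01: "s n \<in> {0..1}" for n
    by (induction n) (use assms in \<open>auto simp: s_rec\<close>)
  have part: "(\<Sum>i<n. real (\<alpha> (Suc i)) / 2 ^ Suc i) = x - s n / 2 ^ n" for n
    by (induction n) (auto simp: s_rec \<alpha>_def field_simps)
  have "(\<lambda>n. s n / 2 ^ n) \<longlonglongrightarrow> 0"
  proof (rule Lim_null_comparison)
    show "\<forall>\<^sub>F n in sequentially. norm (s n / 2 ^ n) \<le> (1/2) ^ n"
      using s01 by (intro always_eventually) (auto simp: power_divide divide_right_mono)
    show "(\<lambda>n. (1/2::real) ^ n) \<longlonglongrightarrow> 0" by (rule LIMSEQ_power_zero) simp
  qed
  from tendsto_diff[OF tendsto_const[of x] this]
  have "(\<lambda>i. real (\<alpha> (Suc i)) / 2 ^ Suc i) sums x"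
    unfolding sums_def part by simp
  then have "binary_value \<alpha> = x" unfolding binary_value_def by (simp add: sums_iff)
  moreover have "binary_seq \<alpha>" by (auto simp: binary_seq_def \<alpha>_def)
  ultimately show ?thesis using that by blast
qed

section \<open>Iterating the functional equation\<close>

text \<open>Both \<open>1 - 2 * x\<close> and \<open>2 - 2 * x\<close> are the complement of what
  remains of \<open>x\<close> after its first binary digit is removed and the rest doubled. That
  digit selects the partial quotient 1/2 or 1.\<close>

fun iterate :: "nat \<Rightarrow> real \<Rightarrow> real" where
  "iterate 0 x = 1 - x / 2"
| "iterate (Suc n) x =
    (if x \<le> 1/2 then 1 / (1/2 + iterate n (1 - 2 * x)) else 1 / (1 + iterate n (2 - 2 * x)))"

text \<open>The two ends are exchanged by the inner arguments. These values make both branches equal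
  to 2/3 at \<open>x = 1/2\<close>, which continuity requires.\<close>

lemma iterate_end: "iterate n 0 = 1 \<and> iterate n 1 = 1/2"
  by (induction n) auto

lemma iterate_bounds: "x \<in> {0..1} \<Longrightarrow> iterate n x \<in> {1/2..1}"
proof (induction n arbitrary: x)
  case (Suc n)
  show ?case
  proof (cases "x \<le> 1/2")
    case True
    then show ?thesis using Suc.IH[of "1 - 2 * x"] Suc.prems by (auto simp: field_simps)
  next
    case False
    then show ?thesis using Suc.IH[of "2 - 2 * x"] Suc.prems by (auto simp: field_simps)
  qed
qed auto

text \<open>Each branch composes three decreasing maps: the inner affine map, the previous iterate
  and \<open>1 / (c + _)\<close>. Across 1/2 the value 2/3 separates the branches.\<close>

lemma iterate_antimono:
  "x \<in> {0..1} \<Longrightarrow> y \<in> {0..1} \<Longrightarrow> x \<le> y \<Longrightarrow> iterate n y \<le> iterate n x"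
proof (induction n arbitrary: x y)
  case (Suc n)
  consider "y \<le> 1/2" | "x \<le> 1/2" "y > 1/2" | "x > 1/2" using Suc.prems by linarith
  then show ?case
  proof cases
    case 1
    then show ?thesis
      using Suc.IH[of "1 - 2 * y" "1 - 2 * x"] Suc.prems iterate_bounds[of "1 - 2 * y" n]
        iterate_bounds[of "1 - 2 * x" n]
      by (auto intro!: divide_left_mono)
  next
    case 2
    have "1 / (1 + iterate n (2 - 2 * y)) \<le> 1 / (1 + 1/2)"
      using iterate_bounds[of "2 - 2 * y" n] 2 Suc.prems by (intro divide_left_mono) auto
    moreover have "1 / (1/2 + 1) \<le> 1 / (1/2 + iterate n (1 - 2 * x))"
      using iterate_bounds[of "1 - 2 * x" n] 2 Suc.prems by (intro divide_left_mono) auto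
    ultimately show ?thesis using 2 by simp
  next
    case 3
    then show ?thesis
      using Suc.IH[of "2 - 2 * y" "2 - 2 * x"] Suc.prems iterate_bounds[of "2 - 2 * y" n]
        iterate_bounds[of "2 - 2 * x" n]
      by (auto intro!: divide_left_mono)
  qed
qed auto

lemma iterate_continuous: "continuous_on {0..1} (iterate n)"
proof (induction n)
  case 0
  then show ?case by (auto intro!: continuous_intros)
next
  case (Suc n)
  have pos: "iterate n x > 0" if "x \<in> {0..1}" for x using iterate_bounds[OF that, of n] by auto
  have left: "continuous_on {x \<in> {0..1}. x \<le> 1/2} (\<lambda>x. 1 / (1/2 + iterate n (1 - 2 * x)))"
  proof (intro continuous_intros continuous_on_compose2[OF Suc])
    show "\<forall>x\<in>{x \<in> {0..1}. x \<le> 1/2}. 1/2 + iterate n (1 - 2 * x) \<noteq> 0"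
    proof
      fix x :: real assume "x \<in> {x \<in> {0..1}. x \<le> 1/2}"
      then show "1/2 + iterate n (1 - 2 * x) \<noteq> 0" using pos[of "1 - 2 * x"] by auto
    qed
  qed auto
  have right: "continuous_on {x \<in> {0..1}. 1/2 \<le> x} (\<lambda>x. 1 / (1 + iterate n (2 - 2 * x)))"
  proof (intro continuous_intros continuous_on_compose2[OF Suc])
    show "\<forall>x\<in>{x \<in> {0..1}. 1/2 \<le> x}. 1 + iterate n (2 - 2 * x) \<noteq> 0"
    proof
      fix x :: real assume "x \<in> {x \<in> {0..1}. 1/2 \<le> x}"
      then show "1 + iterate n (2 - 2 * x) \<noteq> 0" using pos[of "2 - 2 * x"] by auto
    qed
  qed auto
  have "continuous_on {0..1}
    (\<lambda>x. if x \<le> 1/2 then 1 / (1/2 + iterate n (1 - 2 * x)) else 1 / (1 + iterate n (2 - 2 * x)))"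
    using left right
  proof (rule continuous_on_cases_le)
    show "1 / (1/2 + iterate n (1 - 2 * x)) = 1 / (1 + iterate n (2 - 2 * x))"
      if "x \<in> {0..1}" "x = 1/2" for x
      unfolding that(2) by (simp add: iterate_end)
  qed (rule continuous_on_id)
  then show ?case by (simp cong: if_cong)
qed

text \<open>The witness is the \<open>n\<close>-th convergent built from the orbit of
  \<open>x\<close>. It depends on \<open>x\<close> and \<open>n\<close> but not on \<open>m\<close>,
  and the bound does not depend on \<open>x\<close>.\<close>

lemma iterate_near_convergent:
  assumes "x \<in> {0..1}" "0 < n"
  shows "\<exists>c. \<forall>m\<ge>n. \<bar>iterate m x - c\<bar> \<le> 8 / real n"
proof -
  define g where "g y = (if y \<le> 1/2 then 1 - 2 * y else 2 - 2 * y)" for y :: real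
  define a where "a k = (if (g ^^ (k - 1)) x \<le> 1/2 then 1/2 else 1 :: real)" for k
  have orbit: "(g ^^ k) x \<in> {0..1}" for k
    by (induction k) (use assms in \<open>auto simp: g_def\<close>)
  have "\<bar>iterate m x - cf_num a n / cf_den a n\<bar> \<le> 8 / real n" if "m \<ge> n" for m
  proof -
    \<comment> \<open>Each unfolding uses up one level of iteration and moves one step along the
      orbit; \<open>m \<ge> n\<close> leaves enough levels for \<open>n\<close> unfoldings.\<close>
    define t where "t k = iterate (m - k) ((g ^^ k) x)" for k
    have "t k = 1 / (a (Suc k) + t (Suc k))" if "k < n" for k
    proof -
      have "m - k = Suc (m - Suc k)" using that \<open>m \<ge> n\<close> by simp
      then show ?thesis by (simp add: t_def a_def g_def)
    qed
    moreover have "t k > 0" for k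
      using iterate_bounds[OF orbit, of "m - k" k] by (auto simp: t_def)
    ultimately have "\<bar>t 0 - cf_num a n / cf_den a n\<bar> \<le> 8 / real n"
      using assms by (intro cf_convergent_error) (auto simp: a_def)
    then show ?thesis by (simp add: t_def)
  qed
  then show ?thesis by blast
qed

lemma iterate_uniformly_convergent: "uniformly_convergent_on {0..1} iterate"
proof -
  have "uniformly_Cauchy_on {0..1} iterate"
  proof (rule uniformly_Cauchy_onI)
    fix e :: real assume e: "e > 0"
    \<comment> \<open>Two iterates are compared through the common point \<open>c\<close>, at a cost
      of \<open>8 / n\<close> each.\<close>
    obtain n where n: "16 / e < real n" using reals_Archimedean2 by blast
    have n0: "real n > 0" using n e by (smt (verit) divide_pos_pos)
    have small: "16 / real n < e" using n n0 e by (simp add: field_simps)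
    have "dist (iterate k x) (iterate m x) < e" if "x \<in> {0..1}" "k \<ge> n" "m \<ge> n" for x k m
    proof -
      obtain c where c: "\<forall>m\<ge>n. \<bar>iterate m x - c\<bar> \<le> 8 / real n"
        using iterate_near_convergent \<open>x \<in> {0..1}\<close> n0 by (metis of_nat_0_less_iff)
      have "\<bar>iterate k x - c\<bar> \<le> 8 / real n" "\<bar>iterate m x - c\<bar> \<le> 8 / real n"
        using c \<open>k \<ge> n\<close> \<open>m \<ge> n\<close> by auto
      with small show ?thesis
        by (simp add: dist_real_def)
    qed
    then show "\<exists>M. \<forall>x\<in>{0..1}. \<forall>m\<ge>M. \<forall>n\<ge>M. dist (iterate m x) (iterate n x) < e" by blast
  qed
  then show ?thesis by (simp add: uniformly_convergent_eq_Cauchy)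
qed

section \<open>The limit function\<close>

definition flip_limit :: "real \<Rightarrow> real" where
  "flip_limit x = lim (\<lambda>n. iterate n x)"

lemma iterate_uniform_limit: "uniform_limit {0..1} iterate flip_limit sequentially"
  using iterate_uniformly_convergent uniformly_convergent_uniform_limit_iff[of "{0..1}" iterate]
  by (simp add: flip_limit_def[abs_def])

lemma iterate_tendsto: "x \<in> {0..1} \<Longrightarrow> (\<lambda>n. iterate n x) \<longlonglongrightarrow> flip_limit x"
  by (rule tendsto_uniform_limitI[OF iterate_uniform_limit])

lemma flip_limit_continuous: "continuous_on {0..1} flip_limit"
  by (rule uniform_limit_theorem[OF _ iterate_uniform_limit]) (auto simp: iterate_continuous)

lemma flip_limit_bounds: "x \<in> {0..1} \<Longrightarrow> flip_limit x \<in> {1/2..1}"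
  using closed_sequentially[OF closed_atLeastAtMost, of "\<lambda>n. iterate n x" "1/2" 1]
    iterate_tendsto iterate_bounds by blast

lemma flip_limit_antimono:
  "x \<in> {0..1} \<Longrightarrow> y \<in> {0..1} \<Longrightarrow> x \<le> y \<Longrightarrow> flip_limit y \<le> flip_limit x"
  by (rule lim_mono[OF _ iterate_tendsto iterate_tendsto]) (rule iterate_antimono)

lemma flip_limit_0: "flip_limit 0 = 1" and flip_limit_1: "flip_limit 1 = 1/2"
  by (simp_all add: flip_limit_def iterate_end)

lemma flip_limit_left:
  assumes "x \<in> {0..1/2}"
  shows "flip_limit x = 1 / (1/2 + flip_limit (1 - 2 * x))"
proof -
  have y: "1 - 2 * x \<in> {0..1}" using assms by auto
  have "(\<lambda>n. iterate (Suc n) x) \<longlonglongrightarrow> flip_limit x"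
    using assms by (intro LIMSEQ_Suc iterate_tendsto) auto
  moreover have "(\<lambda>n. 1 / (1/2 + iterate n (1 - 2 * x))) \<longlonglongrightarrow> 1 / (1/2 + flip_limit (1 - 2 * x))"
    using flip_limit_bounds[OF y] by (intro tendsto_intros iterate_tendsto y) auto
  ultimately show ?thesis using assms by (auto intro: LIMSEQ_unique)
qed

lemma flip_limit_right:
  assumes "x \<in> {1/2..1}"
  shows "flip_limit x = 1 / (1 + flip_limit (2 - 2 * x))"
proof (cases "x = 1/2")
  case True
  \<comment> \<open>The iterates treat 1/2 by the left branch; the end values 1 and 1/2 turn that
    equation into the right one.\<close>
  show ?thesis using flip_limit_left[of "1/2"] unfolding True by (simp add: flip_limit_0 flip_limit_1)
next
  case False
  have y: "2 - 2 * x \<in> {0..1}" using assms by auto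
  have "(\<lambda>n. iterate (Suc n) x) \<longlonglongrightarrow> flip_limit x"
    using assms by (intro LIMSEQ_Suc iterate_tendsto) auto
  moreover have "(\<lambda>n. 1 / (1 + iterate n (2 - 2 * x))) \<longlonglongrightarrow> 1 / (1 + flip_limit (2 - 2 * x))"
    using flip_limit_bounds[OF y] by (intro tendsto_intros iterate_tendsto y) auto
  ultimately show ?thesis using assms False by (auto intro: LIMSEQ_unique)
qed

text \<open>Neighbours on the grid of level \<open>n + 1\<close> lie in the same closed half, whose
  inner map sends them to neighbours of level \<open>n\<close> in reverse order. The map
  \<open>1 / (c + _)\<close> reverses the strict inequality once more.\<close>

lemma flip_limit_dyadic_step:
  "k < 2 ^ n \<Longrightarrow> flip_limit (real (Suc k) / 2 ^ n) < flip_limit (real k / 2 ^ n)"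
proof (induction n arbitrary: k)
  case 0
  then show ?case by (simp add: flip_limit_0 flip_limit_1)
next
  case (Suc n)
  define N :: nat where "N = 2 ^ n"
  have N: "(2::real) ^ n = real N" "N > 0" by (auto simp: N_def)
  have k: "k < 2 * N" using Suc.prems by (simp add: N_def)
  have step: "1 / (c + flip_limit v) < 1 / (c + flip_limit u)"
    if "0 < c" "flip_limit u < flip_limit v" "u \<in> {0..1}" for c u v
    using that flip_limit_bounds[of u] by (intro divide_strict_left_mono mult_pos_pos) auto
  show ?case
  proof (cases "k < N")
    case True
    \<comment> \<open>The inner map reflects the grid: the points numbered \<open>k\<close> and
      \<open>Suc k\<close> go to those numbered \<open>Suc j\<close> and \<open>j\<close>.\<close>
    define j where "j = N - Suc k"
    have j: "j < 2 ^ n" "real j = real N - real k - 1" using True by (auto simp: j_def N_def)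
    have eqs: "1 - 2 * (real k / 2 ^ Suc n) = real (Suc j) / 2 ^ n"
      "1 - 2 * (real (Suc k) / 2 ^ Suc n) = real j / 2 ^ n"
      using N by (simp_all add: j(2) field_simps)
    have mem: "real k / 2 ^ Suc n \<in> {0..1/2}" "real (Suc k) / 2 ^ Suc n \<in> {0..1/2}"
      using True by (simp_all add: N field_simps)
    have "real (Suc j) \<le> real N" using j(1) unfolding of_nat_le_iff by (simp add: N_def)
    then have "real (Suc j) / 2 ^ n \<in> {0..1}" by (simp add: N)
    then show ?thesis
      unfolding flip_limit_left[OF mem(1)] flip_limit_left[OF mem(2)] eqs
      using Suc.IH[OF j(1)] by (intro step) auto
  next
    case False
    define j where "j = 2 * N - Suc k"
    have j: "j < 2 ^ n" "real j = 2 * real N - real k - 1" using False k by (auto simp: j_def N_def)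
    have eqs: "2 - 2 * (real k / 2 ^ Suc n) = real (Suc j) / 2 ^ n"
      "2 - 2 * (real (Suc k) / 2 ^ Suc n) = real j / 2 ^ n"
      using N by (simp_all add: j(2) field_simps)
    have mem: "real k / 2 ^ Suc n \<in> {1/2..1}" "real (Suc k) / 2 ^ Suc n \<in> {1/2..1}"
      using False k by (simp_all add: N field_simps)
    have "real (Suc j) \<le> real N" using j(1) unfolding of_nat_le_iff by (simp add: N_def)
    then have "real (Suc j) / 2 ^ n \<in> {0..1}" by (simp add: N)
    then show ?thesis
      unfolding flip_limit_right[OF mem(1)] flip_limit_right[OF mem(2)] eqs
      using Suc.IH[OF j(1)] by (intro step) auto
  qed
qed

lemma flip_limit_strict_antimono:
  assumes "x \<in> {0..1}" "y \<in> {0..1}" "x < y"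
  shows "flip_limit y < flip_limit x"
proof -
  \<comment> \<open>The gap exceeds two grid cells, so a whole cell, starting at \<open>x\<close>
    rounded up, fits between \<open>x\<close> and \<open>y\<close>. Weak monotonicity covers the
    rest.\<close>
  obtain n where "2 / (y - x) < 2 ^ n" using real_arch_pow[of 2] by auto
  then have n: "2 < (y - x) * 2 ^ n" using assms by (simp add: field_simps)
  define k where "k = nat \<lceil>x * 2 ^ n\<rceil>"
  have "x * 2 ^ n \<ge> 0" using assms by simp
  then have k: "x * 2 ^ n \<le> real k" "real k < x * 2 ^ n + 1"
    unfolding k_def by linarith+
  have xk: "x \<le> real k / 2 ^ n" and ky: "real (Suc k) / 2 ^ n \<le> y"
    using k n by (auto simp: field_simps)
  have "real (Suc k) \<le> y * 2 ^ n" using ky by (simp add: pos_divide_le_eq)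
  also have "\<dots> \<le> 1 * 2 ^ n" using assms by (intro mult_right_mono) auto
  finally have Suc_k: "real (Suc k) \<le> 2 ^ n" by simp
  then have "real (Suc k) \<le> real (2 ^ n)" by simp
  then have kn: "k < 2 ^ n" unfolding of_nat_le_iff by simp
  have k_le: "real k \<le> 2 ^ n" using Suc_k by linarith
  have mem: "real k / 2 ^ n \<in> {0..1}" "real (Suc k) / 2 ^ n \<in> {0..1}"
    using Suc_k k_le by (auto simp: field_simps)
  have "flip_limit y \<le> flip_limit (real (Suc k) / 2 ^ n)"
    using assms mem ky by (intro flip_limit_antimono) auto
  also have "\<dots> < flip_limit (real k / 2 ^ n)" by (rule flip_limit_dyadic_step[OF kn])
  also have "\<dots> \<le> flip_limit x" using assms mem xk by (intro flip_limit_antimono) auto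
  finally show ?thesis .
qed

text \<open>With \<open>r k\<close> the value of the digits after the first \<open>k\<close>,
  complementing it for odd \<open>k\<close> gives points \<open>z k\<close> whose images under
  \<open>flip_limit\<close> satisfy the tail equations for
  \<open>A2_digits \<alpha>\<close>.\<close>

lemma flip_limit_binary_value:
  assumes "binary_seq \<alpha>"
  shows "flip_limit (binary_value \<alpha>) = cf_value (A2_digits \<alpha>)"
proof -
  define r where "r k = binary_value (\<lambda>n. \<alpha> (n + k))" for k
  define z where "z k = (if even k then r k else 1 - r k)" for k
  have r01: "r k \<in> {0..1}" for k
    unfolding r_def by (intro binary_value_bounds binary_seq_shift assms)
  have z01: "z k \<in> {0..1}" for k using r01[of k] by (auto simp: z_def)
  have r: "r k = (real (\<alpha> (Suc k)) + r (Suc k)) / 2" for k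
    using binary_value_unfold[OF binary_seq_shift[OF assms, of k]] by (simp add: r_def)
  have dig: "\<alpha> (Suc k) = 0 \<or> \<alpha> (Suc k) = 1" for k
    using assms by (auto simp: binary_seq_def)
  have "flip_limit (z k) = 1 / (A2_digits \<alpha> (Suc k) + flip_limit (z (Suc k)))" for k
  \<comment> \<open>The condition says that the leading digit of \<open>z k\<close>, complemented
    for odd \<open>k\<close>, is 0. At \<open>z k = 1/2\<close> either digit may occur, hence the
    functional equations on closed halves.\<close>
  proof (cases "even k = (\<alpha> (Suc k) = 0)")
    case True
    then have "z (Suc k) = 1 - 2 * z k" "A2_digits \<alpha> (Suc k) = 1/2"
      using r[of k] dig[of k] by (auto simp: z_def A2_digits_def)
    then show ?thesis using flip_limit_left[of "z k"] z01[of k] z01[of "Suc k"] by auto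
  next
    case False
    then have "z (Suc k) = 2 - 2 * z k" "A2_digits \<alpha> (Suc k) = 1"
      using r[of k] dig[of k] by (auto simp: z_def A2_digits_def)
    then show ?thesis using flip_limit_right[of "z k"] z01[of k] z01[of "Suc k"] by auto
  qed
  moreover have "flip_limit (z k) > 0" for k using flip_limit_bounds[OF z01, of k] by auto
  moreover have "A2_digits \<alpha> k \<ge> 1/2" if "k \<ge> 1" for k
    using dig[of "k - 1"] that by (auto simp: A2_digits_def)
  ultimately have "cf_value (A2_digits \<alpha>) = flip_limit (z 0)"
    by (rule cf_value_eqI)
  then show ?thesis by (simp add: z_def r_def)
qed

text \<open>Every expansion of \<open>x\<close> yields \<open>flip_limit x\<close>, so the
  description is unique without comparing the two expansions of a dyadic rational.\<close>

lemma binary_to_A2_eq: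
  assumes "x \<in> {0..1}"
  shows "binary_to_A2 x = flip_limit x"
  unfolding binary_to_A2_def
proof (rule the_equality)
  show "\<exists>\<alpha>. binary_seq \<alpha> \<and> x = binary_value \<alpha> \<and> flip_limit x = cf_value (A2_digits \<alpha>)"
    using binary_expansion_exists[OF assms] flip_limit_binary_value by metis
qed (auto simp: flip_limit_binary_value)

theorem theorem3:
  shows "(\<forall>\<alpha>. binary_seq \<alpha> \<longrightarrow> binary_to_A2 (binary_value \<alpha>) = cf_value (A2_digits \<alpha>)) \<and>
    binary_to_A2 ` {0..1} \<subseteq> {1/2..1} \<and>
    continuous_on {0..1} binary_to_A2 \<and>
    strict_antimono_on {0..1} binary_to_A2 \<and>
    binary_to_A2 0 = 1 \<and> binary_to_A2 1 = 1/2"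
proof (intro conjI allI impI)
  show "binary_to_A2 (binary_value \<alpha>) = cf_value (A2_digits \<alpha>)" if "binary_seq \<alpha>" for \<alpha>
    using that binary_to_A2_eq binary_value_bounds flip_limit_binary_value by simp
  show "binary_to_A2 ` {0..1} \<subseteq> {1/2..1}"
    using binary_to_A2_eq flip_limit_bounds by auto
  show "continuous_on {0..1} binary_to_A2"
    using flip_limit_continuous binary_to_A2_eq by (simp cong: continuous_on_cong_simp)
  show "strict_antimono_on {0..1} binary_to_A2"
    by (rule monotone_onI) (simp add: binary_to_A2_eq flip_limit_strict_antimono)
qed (simp_all add: binary_to_A2_eq flip_limit_0 flip_limit_1)

end
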